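(* Let $q$ be a complex number with $|q|<1$. Then the following two identities hold: \begin{align*} \sum_{i,j,k\ge 0}\frac{q^{\frac{1}{2}i^2+\frac{5}{2}j^2+8k^2+ij+2ik+8jk+\frac{1}{2}i-\frac{1}{2}j}}{(q;q)_i(q;q)_j(q^2;q^2)_k} &=\frac{(q^4,q^6,q^{10};q^{10})_\infty}{(q;q)_\infty},\\ \sum_{i,j,k\ge 0}\frac{q^{\frac{1}{2}i^2+\frac{5}{2}j^2+8k^2+ij+2ik+8jk+\frac{1}{2}i+\frac{3}{2}j+4k}}{(q;q)_i(q;q)_j(q^2;q^2)_k} &=\frac{(q^2,q^8,q^{10};q^{10})_\infty}{(q;q)_\infty}. \end{align*}
   Context: For $|q|<1$: $(a;q)_\infty=\prod_{m=0}^\infty(1-aq^m)$, $(a;q)_n=(a;q)_\infty/(aq^n;q)_\infty=\prod_{m=0}^{n-1}(1-aq^m)$ for integers $n\ge0$, and $(a_1,\dots,a_r;q)_\infty=(a_1;q)_\infty\cdots(a_r;q)_\infty$; the same notation is used with the base $q$ replaced by a power of $q$. All exponents of $q$ in the sums are integers. *)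

theory Defs
  imports "HOL-Analysis.Analysis"
begin

definition qpoch_inf :: "complex \<Rightarrow> complex \<Rightarrow> complex" where
  "qpoch_inf a q = (\<Prod>m. 1 - a * q ^ m)"

definition qpoch :: "complex \<Rightarrow> complex \<Rightarrow> nat \<Rightarrow> complex" where
  "qpoch a q n = (\<Prod>m<n. 1 - a * q ^ m)"

definition qpochs_inf :: "complex list \<Rightarrow> complex \<Rightarrow> complex" where
  "qpochs_inf xs q = prod_list (map (\<lambda>a. qpoch_inf a q) xs)"

text \<open>\<open>prodinf\<close> is meaningful only for convergent products; for \<open>norm q < 1\<close> these converge.\<close>

lemma qpoch_inf_has_prod:
  assumes "norm q < 1"
  shows "(\<lambda>m. 1 - a * q ^ m) has_prod qpoch_inf a q"
proof -
  have "summable (\<lambda>m. norm a * norm q ^ m)"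
    using assms by (intro summable_mult summable_geometric) auto
  then have "abs_convergent_prod (\<lambda>m. 1 + (- a * q ^ m))"
    by (intro summable_imp_abs_convergent_prod) (simp add: norm_mult norm_power)
  then have "convergent_prod (\<lambda>m. 1 - a * q ^ m)"
    using abs_convergent_prod_imp_convergent_prod by fastforce
  then show ?thesis
    unfolding qpoch_inf_def by (rule convergent_prod_has_prod)
qed

text \<open>The exponents as natural numbers. Neither the truncated subtraction nor the integer
  division loses anything, as the two lemmas below show.\<close>

definition expo1 :: "nat \<Rightarrow> nat \<Rightarrow> nat \<Rightarrow> nat" where
  "expo1 i j k = (i^2 + 5*j^2 + 16*k^2 + 2*i*j + 4*i*k + 16*j*k + i - j) div 2"

definition expo2 :: "nat \<Rightarrow> nat \<Rightarrow> nat \<Rightarrow> nat" where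
  "expo2 i j k = (i^2 + 5*j^2 + 16*k^2 + 2*i*j + 4*i*k + 16*j*k + i + 3*j + 8*k) div 2"

lemma real_expo1:
  "real (expo1 i j k) = 1/2 * real i ^ 2 + 5/2 * real j ^ 2 + 8 * real k ^ 2
     + real i * real j + 2 * real i * real k + 8 * real j * real k
     + 1/2 * real i - 1/2 * real j"
proof -
  let ?N = "i^2 + 5*j^2 + 16*k^2 + 2*i*j + 4*i*k + 16*j*k + i"
  have le: "j \<le> ?N"
    using self_le_power[of j 2] by (cases "j = 0") auto
  have "even (?N - j)"
    using le by (auto simp: even_diff_nat)
  then have "real (expo1 i j k) = real (?N - j) / 2"
    unfolding expo1_def by (simp add: real_of_nat_div)
  also have "\<dots> = (real ?N - real j) / 2"
    using le by (simp only: of_nat_diff)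
  finally show ?thesis
    by (simp add: field_simps)
qed

lemma real_expo2:
  "real (expo2 i j k) = 1/2 * real i ^ 2 + 5/2 * real j ^ 2 + 8 * real k ^ 2
     + real i * real j + 2 * real i * real k + 8 * real j * real k
     + 1/2 * real i + 3/2 * real j + 4 * real k"
proof -
  let ?N = "i^2 + 5*j^2 + 16*k^2 + 2*i*j + 4*i*k + 16*j*k + i + 3*j + 8*k"
  have "even ?N"
    by auto
  then have "real (expo2 i j k) = real ?N / 2"
    unfolding expo2_def by (simp only: real_of_nat_div of_nat_numeral)
  then show ?thesis
    by (simp add: field_simps)
qed

end

theory Submission imports Defs begin

text \<open>
  Put \<open>n = j + 2 * k\<close>. The exponent of \<open>q\<close> then splits as
  \<open>i(i-1)/2 + (1 + n) i\<close>, plus \<open>j(j-1)/2\<close>, plus \<open>2 n (n + e)\<close>, with \<open>e = 0\<close> for the first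
  identity and \<open>e = 1\<close> for the second, so the triple sum can be done one layer at a time.
  
  \<^item> The sum over \<open>i\<close> is Euler's series (\<open>Euler_series\<close>) and gives
    \<open>(-q^(n+1);q)\<^sub>\<infinity> = (-q;q)\<^sub>\<infinity> / (-q;q)\<^sub>n\<close>.
  \<^item> The finite sum over the pairs with \<open>j + 2 * k = n\<close> equals \<open>1 / (q;q)\<^sub>n\<close>
    (\<open>sum_weighted_pairs\<close>).
  \<^item> As \<open>(q;q)\<^sub>n (-q;q)\<^sub>n = (q^2;q^2)\<^sub>n\<close>, what remains is \<open>(-q;q)\<^sub>\<infinity>\<close> times the Rogers-Ramanujan
    series \<open>\<Sum>n. p^(n(n+e)) / (p;p)\<^sub>n\<close> in the base \<open>p = q^2\<close>. Its product formula, and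
    \<open>(-q;q)\<^sub>\<infinity> = (q^2;q^2)\<^sub>\<infinity> / (q;q)\<^sub>\<infinity>\<close>, give the right-hand sides.
  
  Absolute convergence of the triple series, which justifies the rearrangement, holds because the
  exponent is at least \<open>i + j + k\<close> while the denominators stay away from zero.
  
  The Rogers-Ramanujan identities are proved with Bailey's lemma. A sequence \<open>\<alpha>\<close> is sent to
  \<open>B(\<alpha>)\<^sub>n = (\<Sum>r\<le>n. \<alpha>\<^sub>r / ((q;q)\<^sub>n\<^sub>-\<^sub>r (q;q)\<^sub>n\<^sub>+\<^sub>r\<^sub>+\<^sub>e))\<close>, and \<open>bailey_chain\<close>, which is a form of the
  q-Vandermonde summation, tells how \<open>B(\<alpha>)\<close> changes when \<open>\<alpha>\<^sub>r\<close> is multiplied by \<open>q^(r(r+e))\<close>. A finite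
  form of Jacobi's triple product (\<open>finite_triple_product\<close>) supplies an \<open>\<alpha>\<close> whose transform
  is \<open>1, 0, 0, ...\<close>. Two steps along the chain give the finite identity \<open>bailey_chain_twice\<close>;
  in the limit its left-hand side is the Rogers-Ramanujan series and its right-hand side a
  theta series, which \<open>triple_product_series\<close>, in the base \<open>q^5\<close>, turns into a product.
\<close>

section \<open>Gaussian binomials and the q-Vandermonde summation\<close>

abbreviation qfact :: "complex \<Rightarrow> nat \<Rightarrow> complex" where
  "qfact q n \<equiv> qpoch q q n"

lemma qpoch_0 [simp]: "qpoch a q 0 = 1"
  by (simp add: qpoch_def)

lemma qpoch_Suc: "qpoch a q (Suc n) = qpoch a q n * (1 - a * q ^ n)"
  by (simp add: qpoch_def)

lemma qpoch_Suc_left: "qpoch a q (Suc n) = (1 - a) * qpoch (a * q) q n"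
  unfolding qpoch_def by (subst prod.lessThan_Suc_shift) (simp add: mult.assoc)

lemma qfact_Suc: "qfact q (Suc n) = qfact q n * (1 - q ^ Suc n)"
  by (simp add: qpoch_Suc)

lemma power_neq_one:
  fixes q :: complex
  assumes "norm q < 1" "n > 0"
  shows "q ^ n \<noteq> 1"
proof
  assume "q ^ n = 1"
  then have "norm q ^ n = 1"
    by (metis norm_one norm_power)
  moreover have "norm q ^ n < 1"
    using assms by (intro power_less_one_iff[THEN iffD2]) auto
  ultimately show False by simp
qed

lemma qfact_nonzero:
  assumes "norm q < 1"
  shows "qfact q n \<noteq> 0"
proof -
  have "1 - q * q ^ m \<noteq> 0" for m
    using power_neq_one[OF assms, of "Suc m"] by auto
  then show ?thesis
    by (simp add: qpoch_def)
qed

definition qbinom :: "complex \<Rightarrow> nat \<Rightarrow> nat \<Rightarrow> complex" where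
  "qbinom q n k = (if k \<le> n then qfact q n / (qfact q k * qfact q (n - k)) else 0)"

lemma qbinom_0 [simp]: "norm q < 1 \<Longrightarrow> qbinom q n 0 = 1"
  by (simp add: qbinom_def qfact_nonzero)

lemma qbinom_Suc_Suc:
  assumes "norm q < 1"
  shows "qbinom q (Suc n) (Suc k) = qbinom q n k + q ^ Suc k * qbinom q n (Suc k)"
proof -
  note nz = qfact_nonzero[OF assms]
  consider "k > n" | "k = n" | "k < n" by linarith
  then show ?thesis
  proof cases
    case 3
    then obtain m where m: "n = Suc (k + m)"
      using less_iff_Suc_add by auto
    have "1 - q ^ Suc k \<noteq> 0" "1 - q ^ Suc m \<noteq> 0"
      using power_neq_one[OF assms, of "Suc k"] power_neq_one[OF assms, of "Suc m"] by auto
    then have "qfact q n / (qfact q k * qfact q (Suc m)) +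
        q ^ Suc k * (qfact q n / (qfact q (Suc k) * qfact q m)) =
        qfact q n / (qfact q (Suc k) * qfact q (Suc m)) *
        ((1 - q ^ Suc k) + q ^ Suc k * (1 - q ^ Suc m))"
      using nz[of k] nz[of m] by (simp add: qfact_Suc[of q k] qfact_Suc[of q m] divide_simps)
         (simp add: algebra_simps)
    also have "(1 - q ^ Suc k) + q ^ Suc k * (1 - q ^ Suc m) = 1 - q ^ Suc n"
      unfolding m by (simp add: algebra_simps power_add)
    finally show ?thesis
      by (simp add: qbinom_def m qfact_Suc[of q "Suc (k + m)"] Suc_diff_le)
  qed (simp_all add: qbinom_def nz)
qed

text \<open>
  Summation against a row of Gaussian binomials reduces to the previous row. Both the
  q-binomial theorem and the q-Vandermonde summation are inductions driven by this rule.
\<close>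

lemma sum_qbinom_Suc:
  assumes "norm q < 1"
  shows "(\<Sum>k\<le>Suc n. qbinom q (Suc n) k * f k) =
         (\<Sum>k\<le>n. qbinom q n k * (q ^ k * f k + f (Suc k)))"
proof -
  have "(\<Sum>k\<le>Suc n. qbinom q (Suc n) k * f k) =
      f 0 + (\<Sum>k\<le>n. (qbinom q n k + q ^ Suc k * qbinom q n (Suc k)) * f (Suc k))"
    by (simp only: sum.atMost_Suc_shift qbinom_Suc_Suc[OF assms] qbinom_0[OF assms] mult_1)
  also have "\<dots> = (\<Sum>k\<le>n. qbinom q n k * f (Suc k)) +
      (f 0 + (\<Sum>k\<le>n. q ^ Suc k * qbinom q n (Suc k) * f (Suc k)))"
    by (simp add: algebra_simps sum.distrib)
  also have "f 0 + (\<Sum>k\<le>n. q ^ Suc k * qbinom q n (Suc k) * f (Suc k)) =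
      (\<Sum>k\<le>Suc n. q ^ k * qbinom q n k * f k)"
    using assms by (subst sum.atMost_Suc_shift) simp
  also have "\<dots> = (\<Sum>k\<le>n. q ^ k * qbinom q n k * f k)"
    by (simp add: qbinom_def)
  finally show ?thesis
    by (simp add: algebra_simps sum.distrib)
qed

lemma Suc_choose_two: "Suc n choose 2 = n + (n choose 2)"
  by (simp add: numeral_2_eq_2)

lemma add_choose_two: "(m + r) choose 2 = (m choose 2) + m * r + (r choose 2)"
  by (induction r) (auto simp: Suc_choose_two)

lemma double_choose_two: "2 * (r choose 2) + r = r * r"
  by (induction r) (auto simp: Suc_choose_two numeral_2_eq_2)

theorem q_binomial_theorem:
  assumes "norm q < 1"
  shows "(\<Sum>k\<le>n. qbinom q n k * (q ^ (k choose 2) * x ^ k)) = (\<Prod>i<n. 1 + x * q ^ i)"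
proof (induction n arbitrary: x)
  case (Suc n)
  have "(\<Sum>k\<le>Suc n. qbinom q (Suc n) k * (q ^ (k choose 2) * x ^ k)) =
      (1 + x) * (\<Sum>k\<le>n. qbinom q n k * (q ^ (k choose 2) * (x * q) ^ k))"
    unfolding sum_qbinom_Suc[OF assms] sum_distrib_left
    by (intro sum.cong) (auto simp: Suc_choose_two power_add power_mult_distrib algebra_simps)
  also have "\<dots> = (1 + x) * (\<Prod>i<n. 1 + x * q ^ Suc i)"
    unfolding Suc.IH by (simp add: mult.assoc)
  also have "\<dots> = (\<Prod>i<Suc n. 1 + x * q ^ i)"
    by (subst prod.lessThan_Suc_shift) simp
  finally show ?case .
qed (use assms in \<open>simp add: numeral_2_eq_2\<close>)

text \<open>
  Passing from \<open>M\<close> to \<open>M + 1\<close> by the Pascal rule merges two neighbouring terms into the term with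
  \<open>t + 1\<close> in place of \<open>t\<close>; so the sum depends on \<open>M + t\<close> only, and \<open>M = 0\<close> is trivial.
\<close>

lemma q_Vandermonde:
  assumes "norm q < 1"
  shows "(\<Sum>m\<le>M. qbinom q M m * (q ^ (m * (m + t)) / qfact q (m + t))) = 1 / qfact q (M + t)"
proof (induction M arbitrary: t)
  case (Suc M)
  have *: "q ^ m * (q ^ (m * (m + t)) / qfact q (m + t)) +
      q ^ (Suc m * (Suc m + t)) / qfact q (Suc m + t) =
      q ^ (m * (m + Suc t)) / qfact q (m + Suc t)" for m
  proof -
    have nz: "1 - q ^ Suc (m + t) \<noteq> 0"
      using power_neq_one[OF assms, of "Suc (m + t)"] by auto
    have "q ^ (Suc m * (Suc m + t)) = q ^ m * q ^ (m * (m + t)) * q ^ Suc (m + t)"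
      by (simp flip: power_add add: algebra_simps)
    moreover have "q ^ (m * (m + Suc t)) = q ^ m * q ^ (m * (m + t))"
      by (simp flip: power_add add: algebra_simps)
    ultimately show ?thesis
      using nz qfact_nonzero[OF assms, of "m + t"]
      by (simp add: qfact_Suc[of q "m + t"] divide_simps) (simp add: algebra_simps)
  qed
  show ?case
    unfolding sum_qbinom_Suc[OF assms] * using Suc.IH[of "Suc t"] by simp
qed (use assms in simp)

section \<open>Bailey's lemma\<close>

text \<open>
  The \<open>\<beta>\<close> of a Bailey pair \<open>(\<alpha>, \<beta>)\<close> relative to \<open>a = q^e\<close>, up to the constant
  \<open>(q;q)\<^sub>e\<close>: the standard denominator \<open>(aq;q)\<^sub>n\<^sub>+\<^sub>r\<close> is \<open>(q;q)\<^sub>n\<^sub>+\<^sub>r\<^sub>+\<^sub>e / (q;q)\<^sub>e\<close>.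
\<close>

definition bailey_sum :: "complex \<Rightarrow> nat \<Rightarrow> (nat \<Rightarrow> complex) \<Rightarrow> nat \<Rightarrow> complex" where
  "bailey_sum q e \<alpha> n = (\<Sum>r\<le>n. \<alpha> r / (qfact q (n - r) * qfact q (n + r + e)))"

text \<open>
  After interchanging the two sums, the inner one over \<open>s\<close> is the q-Vandermonde summation for
  \<open>m = s - r\<close>, \<open>M = N - r\<close> and \<open>t = 2 * r + e\<close>, because
  \<open>s(s+e) - r(r+e) = m(m+t)\<close>.
\<close>

theorem bailey_chain:
  assumes "norm q < 1"
  shows "(\<Sum>s\<le>N. q ^ (s * (s + e)) / qfact q (N - s) * bailey_sum q e \<alpha> s) =
         bailey_sum q e (\<lambda>r. q ^ (r * (r + e)) * \<alpha> r) N"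
proof -
  have inner: "(\<Sum>s\<in>{r..N}. q ^ (s * (s + e)) / (qfact q (N - s) * (qfact q (s - r) * qfact q (s + r + e)))) =
      q ^ (r * (r + e)) / (qfact q (N - r) * qfact q (N + r + e))" if "r \<le> N" for r
  proof -
    define M where "M = N - r"
    have N: "N = M + r" using that by (simp add: M_def)
    have "(\<Sum>s\<in>{r..N}. q ^ (s * (s + e)) / (qfact q (N - s) * (qfact q (s - r) * qfact q (s + r + e)))) =
        (\<Sum>m\<le>M. q ^ ((m + r) * (m + r + e)) /
           (qfact q (M - m) * (qfact q m * qfact q (m + (2 * r + e)))))"
      by (rule sum.reindex_bij_witness[of _ "\<lambda>m. m + r" "\<lambda>s. s - r"]) (auto simp: N algebra_simps)
    also have "\<dots> = q ^ (r * (r + e)) / qfact q M *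
        (\<Sum>m\<le>M. qbinom q M m * (q ^ (m * (m + (2 * r + e))) / qfact q (m + (2 * r + e))))"
      unfolding sum_distrib_left
    proof (intro sum.cong refl)
      fix m assume "m \<in> {..M}"
      moreover have "(m + r) * (m + r + e) = r * (r + e) + m * (m + (2 * r + e))"
        by (simp add: algebra_simps)
      then have "q ^ ((m + r) * (m + r + e)) = q ^ (r * (r + e)) * q ^ (m * (m + (2 * r + e)))"
        by (simp only: power_add)
      ultimately show "q ^ ((m + r) * (m + r + e)) /
           (qfact q (M - m) * (qfact q m * qfact q (m + (2 * r + e)))) =
          q ^ (r * (r + e)) / qfact q M *
          (qbinom q M m * (q ^ (m * (m + (2 * r + e))) / qfact q (m + (2 * r + e))))"
        using qfact_nonzero[OF assms] by (simp add: qbinom_def)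
    qed
    finally show ?thesis
      unfolding q_Vandermonde[OF assms] by (simp add: N algebra_simps mult_2_right)
  qed
  have "(\<Sum>s\<le>N. q ^ (s * (s + e)) / qfact q (N - s) * bailey_sum q e \<alpha> s) =
     (\<Sum>s\<le>N. \<Sum>r\<le>s. \<alpha> r * (q ^ (s * (s + e)) / (qfact q (N - s) * (qfact q (s - r) * qfact q (s + r + e)))))"
    by (simp add: bailey_sum_def sum_distrib_left mult_ac)
  also have "\<dots> = (\<Sum>r\<le>N. \<Sum>s\<in>{r..N}. \<alpha> r * (q ^ (s * (s + e)) / (qfact q (N - s) * (qfact q (s - r) * qfact q (s + r + e)))))"
    unfolding sum.Sigma[OF finite_atMost ballI[OF finite_atMost]] 
      sum.Sigma[OF finite_atMost ballI[OF finite_atLeastAtMost]]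
    by (rule sum.reindex_bij_witness[of _ "\<lambda>(r, s). (s, r)" "\<lambda>(s, r). (r, s)"]) auto
  also have "\<dots> = (\<Sum>r\<le>N. \<alpha> r * (q ^ (r * (r + e)) / (qfact q (N - r) * qfact q (N + r + e))))"
    by (intro sum.cong refl) (simp only: inner atMost_iff flip: sum_distrib_left)
  finally show ?thesis
    by (simp add: bailey_sum_def mult_ac)
qed

section \<open>A finite form of the triple product\<close>

lemma qpoch_add: "qpoch a q (m + n) = qpoch a q m * qpoch (a * q ^ m) q n"
  by (induction n) (simp_all add: qpoch_Suc power_add mult.assoc)

text \<open>
  The terms of the q-binomial theorem. If \<open>x * q ^ n = - z\<close> and \<open>z * w = q\<close>, the terms on either side
  of index \<open>n\<close> are, relative to the term at \<open>n\<close>, those of the bilateral theta series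
  \<open>\<Sum>r. (-1)^r q^(r(r-1)/2) z^r\<close>; negative \<open>r\<close> are expressed through powers of \<open>w\<close>.
\<close>

definition q_binomial_term :: "complex \<Rightarrow> complex \<Rightarrow> nat \<Rightarrow> complex" where
  "q_binomial_term q x k = q ^ (k choose 2) * x ^ k"

lemma q_binomial_term_up:
  assumes "x * q ^ n = - z"
  shows "q_binomial_term q x (n + r) = q_binomial_term q x n * ((- 1) ^ r * q ^ (r choose 2) * z ^ r)"
proof -
  have "q_binomial_term q x (n + r) = q_binomial_term q x n * (q ^ (r choose 2) * (x * q ^ n) ^ r)"
    unfolding power_mult_distrib power_mult[symmetric]
    by (simp add: q_binomial_term_def add_choose_two power_add)
  then show ?thesis
    unfolding assms power_minus[of z] by (simp add: mult_ac)
qed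

lemma q_binomial_term_down:
  assumes x: "x * q ^ n = - z" and q: "q \<noteq> 0" and zw: "z * w = q" and "r \<le> n"
  shows "q_binomial_term q x (n - r) = q_binomial_term q x n * ((- 1) ^ r * q ^ (r choose 2) * w ^ r)"
proof -
  define m where "m = n - r"
  have n: "n = m + r" using assms by (simp add: m_def)
  have "m * r + (r choose 2) + (r choose 2) + r = n * r"
    using double_choose_two[of r] by (simp add: n algebra_simps)
  then have e: "q ^ (m * r) * q ^ (r choose 2) * q ^ (r choose 2) * q ^ r = (q ^ n) ^ r"
    by (simp flip: power_add power_mult)
  have "q_binomial_term q x n * ((- 1) ^ r * q ^ (r choose 2) * w ^ r) * q ^ r =
      q_binomial_term q x m * (q ^ (m * r) * q ^ (r choose 2) * q ^ (r choose 2) * q ^ r) * (x ^ r * (- 1) ^ r * w ^ r)"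
    by (simp add: q_binomial_term_def n add_choose_two power_add)
  also have "\<dots> = q_binomial_term q x m * (- (x * q ^ n) * w) ^ r"
    unfolding e by (simp add: mult_ac flip: power_mult_distrib)
  also have "- (x * q ^ n) * w = q"
    unfolding x using zw by simp
  finally show ?thesis using q by (simp add: m_def)
qed

text \<open>
  Of the factors \<open>1 + x * q ^ i\<close>, those with \<open>i \<ge> n\<close> give \<open>(z;q)\<^sub>l\<close> at once. In the others
  the summand \<open>x * q ^ i\<close>, which is \<open>- z\<close> times a negative power of \<open>q\<close>, is pulled out: what is
  left is \<open>(w;q)\<^sub>n\<close> in reverse order, and the extracted monomials multiply to the middle term.
\<close>

lemma prod_eq_q_binomial_term:
  assumes x: "x * q ^ n = - z" and q: "q \<noteq> 0" and zw: "z * w = q"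
  shows "(\<Prod>i<n + l. 1 + x * q ^ i) = q_binomial_term q x n * qpoch w q n * qpoch z q l"
proof -
  have *: "(\<Prod>i<n. 1 + x * q ^ i) = q_binomial_term q x n * qpoch w q n"
  proof -
    have "(\<Prod>i<n. 1 + x * q ^ i) = (\<Prod>i<n. x * q ^ i * (1 - w * q ^ (n - Suc i)))"
    proof (intro prod.cong refl)
      fix i assume "i \<in> {..<n}"
      then have "q ^ n = q ^ i * q ^ (n - Suc i) * q"
        by (simp flip: power_add power_Suc2)
      \<comment> \<open>Multiplying by \<open>z\<close> brings in \<open>z * w = q\<close>, which completes the power to \<open>x * q ^ n = - z\<close>.\<close>
      then have "z * (x * q ^ i * (w * q ^ (n - Suc i))) = - z"
        using x zw by (auto simp: algebra_simps)
      then have "x * q ^ i * (w * q ^ (n - Suc i)) = -1"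
        using q zw by (metis minus_mult_right mult_cancel_left mult_zero_left mult.right_neutral)
      then show "1 + x * q ^ i = x * q ^ i * (1 - w * q ^ (n - Suc i))"
        by (simp add: algebra_simps)
    qed
    also have "\<dots> = (\<Prod>i<n. x * q ^ i) * (\<Prod>i<n. 1 - w * q ^ (n - Suc i))"
      by (simp add: prod.distrib)
    also have "(\<Prod>i<n. x * q ^ i) = q_binomial_term q x n"
      by (induction n) (simp_all add: q_binomial_term_def Suc_choose_two power_add numeral_2_eq_2 algebra_simps)
    also have "(\<Prod>i<n. 1 - w * q ^ (n - Suc i)) = qpoch w q n"
      unfolding qpoch_def by (rule prod.nat_diff_reindex)
    finally show ?thesis .
  qed
  have "(\<Prod>i<n + l. 1 + x * q ^ i) = (\<Prod>i<n. 1 + x * q ^ i) * (\<Prod>i<l. 1 + x * q ^ (n + i))"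
    by (induction l) (simp_all add: mult.assoc)
  also have "(\<Prod>i<l. 1 + x * q ^ (n + i)) = qpoch z q l"
    unfolding qpoch_def by (intro prod.cong refl) (simp add: power_add x flip: mult.assoc)
  finally show ?thesis unfolding * .
qed

lemma sum_fold_even:
  fixes f :: "nat \<Rightarrow> 'a :: ab_group_add"
  shows "(\<Sum>k\<le>2 * n. f k) = (\<Sum>r\<le>n. if r = 0 then f n else f (n + r) + f (n - r))"
proof -
  have "(\<Sum>k\<le>2 * n. f k) = (\<Sum>k\<in>{..<n} \<union> {n} \<union> {n<..2*n}. f k)"
    by (intro sum.cong) auto
  also have "\<dots> = (\<Sum>k<n. f k) + f n + (\<Sum>k\<in>{n<..2*n}. f k)"
    by (subst sum.union_disjoint; auto simp: add.commute)+
  also have "(\<Sum>k<n. f k) = (\<Sum>r\<in>{0<..n}. f (n - r))"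
    by (rule sum.reindex_bij_witness[of _ "\<lambda>r. n - r" "\<lambda>r. n - r"]) auto
  also have "(\<Sum>k\<in>{n<..2*n}. f k) = (\<Sum>r\<in>{0<..n}. f (n + r))"
    by (rule sum.reindex_bij_witness[of _ "\<lambda>r. n + r" "\<lambda>r. r - n"]) auto
  also have "(\<Sum>r\<in>{0<..n}. f (n - r)) + f n + (\<Sum>r\<in>{0<..n}. f (n + r)) =
      f n + (\<Sum>r\<in>{0<..n}. f (n + r) + f (n - r))"
    by (simp add: sum.distrib algebra_simps)
  also have "\<dots> = (\<Sum>r\<in>insert 0 {0<..n}. if r = 0 then f n else f (n + r) + f (n - r))"
    by (subst sum.insert) auto
  also have "insert 0 {0<..n} = {..n}" by auto
  finally show ?thesis .
qed

lemma sum_fold_odd: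
  fixes f :: "nat \<Rightarrow> 'a :: ab_group_add"
  shows "(\<Sum>k\<le>2 * n + 1. f k) = (\<Sum>r\<le>n. f (n + Suc r) + f (n - r))"
proof -
  have "(\<Sum>k\<le>2 * n + 1. f k) = (\<Sum>k\<in>{..n} \<union> {n<..2*n+1}. f k)"
    by (intro sum.cong) auto
  also have "\<dots> = (\<Sum>k\<le>n. f k) + (\<Sum>k\<in>{n<..2*n+1}. f k)"
    by (subst sum.union_disjoint) auto
  also have "(\<Sum>k\<le>n. f k) = (\<Sum>r\<le>n. f (n - r))"
    by (rule sum.reindex_bij_witness[of _ "\<lambda>r. n - r" "\<lambda>r. n - r"]) auto
  also have "(\<Sum>k\<in>{n<..2*n+1}. f k) = (\<Sum>r\<le>n. f (n + Suc r))"
    by (rule sum.reindex_bij_witness[of _ "\<lambda>r. n + Suc r" "\<lambda>r. r - Suc n"]) auto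
  finally show ?thesis by (simp add: sum.distrib algebra_simps)
qed

text \<open>
  Let \<open>t\<^sub>r = (-1)^r q^(r(r-1)/2) z^r\<close> for all integers \<open>r\<close>, with \<open>z * w = q\<close>. The bilateral series of
  the \<open>t\<^sub>r\<close> is folded to a series over the naturals, about \<open>r = 0\<close> if \<open>e = 0\<close>, with terms
  \<open>t\<^sub>0\<close> and \<open>t\<^sub>r + t\<^sub>-\<^sub>r\<close>, and about \<open>r = 1/2\<close> if \<open>e = 1\<close>, with terms \<open>t\<^sub>-\<^sub>r + t\<^sub>r\<^sub>+\<^sub>1\<close>.
\<close>

definition theta_term :: "nat \<Rightarrow> complex \<Rightarrow> complex \<Rightarrow> complex \<Rightarrow> nat \<Rightarrow> complex" where
  "theta_term e q z w r = (- 1) ^ r * q ^ (r choose 2) *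
     (if e = 0 then if r = 0 then 1 else z ^ r + w ^ r else w ^ r - q ^ r * z ^ Suc r)"

text \<open>
  This is the q-binomial theorem for row \<open>2 * n + e\<close>, folded about its middle and divided by the
  middle term.
\<close>

theorem finite_triple_product:
  assumes q: "norm q < 1" "q \<noteq> 0" and zw: "z * w = q" and e: "e \<le> 1"
  shows "bailey_sum q e (theta_term e q z w) n =
         qpoch z q (n + e) * qpoch w q n / qfact q (2 * n + e)"
proof -
  define x where "x = - z / q ^ n"
  have x: "x * q ^ n = - z" using q by (simp add: x_def)
  have "x \<noteq> 0" using q zw by (auto simp: x_def)
  then have g: "q_binomial_term q x n \<noteq> 0" using q by (simp add: q_binomial_term_def)
  define f where "f k = qbinom q (2 * n + e) k * q_binomial_term q x k" for k
  have "(\<Sum>k\<le>2 * n + e. f k) = q_binomial_term q x n * (qpoch w q n * qpoch z q (n + e))"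
    using prod_eq_q_binomial_term[OF x q(2) zw, of "n + e"] 
      q_binomial_theorem[OF q(1), of "2 * n + e" x]
    by (simp add: f_def q_binomial_term_def mult_2 add.assoc)
  moreover have "(\<Sum>k\<le>2 * n + e. f k) =
      q_binomial_term q x n * (qfact q (2 * n + e) * bailey_sum q e (theta_term e q z w) n)"
  proof -
    consider "e = 0" | "e = 1" using e by linarith
    then show ?thesis
    proof cases
      case 1
      have "(\<Sum>k\<le>2 * n. f k) = (\<Sum>r\<le>n. if r = 0 then f n else f (n + r) + f (n - r))"
        by (rule sum_fold_even)
      also have "\<dots> = (\<Sum>r\<le>n. q_binomial_term q x n * (qfact q (2 * n) *
          (theta_term 0 q z w r / (qfact q (n - r) * qfact q (n + r)))))"
      proof (intro sum.cong refl)
        fix r assume r: "r \<in> {..n}"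
        have "2 * n - (n + r) = n - r" "2 * n - (n - r) = n + r" using r by auto
        then show "(if r = 0 then f n else f (n + r) + f (n - r)) = q_binomial_term q x n * (qfact q (2 * n) *
          (theta_term 0 q z w r / (qfact q (n - r) * qfact q (n + r))))"
          using r q_binomial_term_up[OF x, of r] q_binomial_term_down[OF x q(2) zw, of r]
          by (simp add: f_def 1 qbinom_def theta_term_def add_divide_distrib numeral_2_eq_2 algebra_simps)
      qed
      finally show ?thesis
        by (simp add: 1 bailey_sum_def sum_distrib_left)
    next
      case 2
      have "(\<Sum>k\<le>2 * n + 1. f k) = (\<Sum>r\<le>n. f (n + Suc r) + f (n - r))"
        by (rule sum_fold_odd)
      also have "\<dots> = (\<Sum>r\<le>n. q_binomial_term q x n * (qfact q (2 * n + 1) *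
          (theta_term 1 q z w r / (qfact q (n - r) * qfact q (n + r + 1)))))"
      proof (intro sum.cong refl)
        fix r assume r: "r \<in> {..n}"
        have "2 * n + 1 - (n + Suc r) = n - r" "2 * n + 1 - (n - r) = n + Suc r" using r by auto
        then show "f (n + Suc r) + f (n - r) = q_binomial_term q x n * (qfact q (2 * n + 1) *
          (theta_term 1 q z w r / (qfact q (n - r) * qfact q (n + r + 1))))"
          using r unfolding f_def q_binomial_term_up[OF x, of "Suc r"] q_binomial_term_down[OF x q(2) zw, of r, simplified] 
          using q_binomial_term_down[OF x q(2) zw, of r]
          by (simp add: 2 qbinom_def theta_term_def diff_divide_distrib Suc_choose_two power_add algebra_simps)
      qed
      finally show ?thesis
        by (simp add: 2 bailey_sum_def sum_distrib_left)
    qed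
  qed
  ultimately have "qfact q (2 * n + e) * bailey_sum q e (theta_term e q z w) n =
      qpoch z q (n + e) * qpoch w q n"
    using g by simp
  then show ?thesis
    using qfact_nonzero[OF q(1), of "2 * n + e"] by (simp add: field_simps)
qed

text \<open>
  The arguments are chosen so that one of them is 1 and the product side, which contains
  \<open>(1;q)\<^sub>n\<close>, vanishes for positive \<open>n\<close>.
\<close>

corollary unit_bailey_pair:
  assumes q: "norm q < 1" "q \<noteq> 0" and e: "e \<le> 1"
  shows "bailey_sum q e (theta_term e q (q ^ e) (q ^ (1 - e))) n = (if n = 0 then 1 else 0)"
proof -
  have zw: "q ^ e * q ^ (1 - e) = q"
    using e by (simp flip: power_add)
  have one: "qpoch 1 q n = 0" if "n > 0"
    using that by (cases n) (simp_all add: qpoch_Suc_left)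
  consider "e = 0" | "e = 1" using e by linarith
  then show ?thesis
  proof cases
    case 1
    then show ?thesis
      using one finite_triple_product[OF q zw e, of n] by auto
  next
    case 2
    then show ?thesis
      using one finite_triple_product[OF q zw e, of n] qfact_nonzero[OF q(1), of 1] by auto
  qed
qed

text \<open>
  The first step along the chain turns \<open>1, 0, 0, ...\<close> into \<open>1 / (q;q)\<^sub>n\<close>; the second one puts
  the Rogers-Ramanujan summand on the left.
\<close>

corollary bailey_chain_twice:
  assumes q: "norm q < 1" "q \<noteq> 0" and e: "e \<le> 1"
  shows "(\<Sum>n\<le>N. q ^ (n * (n + e)) / qfact q n / qfact q (N - n)) =
    bailey_sum q e (\<lambda>r. q ^ (2 * (r * (r + e))) * theta_term e q (q ^ e) (q ^ (1 - e)) r) N"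
proof -
  define \<alpha> where "\<alpha> = theta_term e q (q ^ e) (q ^ (1 - e))"
  have first: "bailey_sum q e (\<lambda>r. q ^ (r * (r + e)) * \<alpha> r) n = 1 / qfact q n" for n
  proof -
    have "bailey_sum q e (\<lambda>r. q ^ (r * (r + e)) * \<alpha> r) n =
       (\<Sum>s\<le>n. q ^ (s * (s + e)) / qfact q (n - s) * bailey_sum q e \<alpha> s)"
      by (rule bailey_chain[OF q(1), symmetric])
    also have "\<dots> = (\<Sum>s\<le>n. if s = 0 then 1 / qfact q n else 0)"
      by (intro sum.cong refl) (simp only: \<alpha>_def unit_bailey_pair[OF q e], simp)
    finally show ?thesis by simp
  qed
  have "(\<Sum>n\<le>N. q ^ (n * (n + e)) / qfact q n / qfact q (N - n)) =
      (\<Sum>n\<le>N. q ^ (n * (n + e)) / qfact q (N - n) *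
         bailey_sum q e (\<lambda>r. q ^ (r * (r + e)) * \<alpha> r) n)"
    unfolding first by (simp add: mult.commute)
  also have "\<dots> = bailey_sum q e (\<lambda>r. q ^ (r * (r + e)) * (q ^ (r * (r + e)) * \<alpha> r)) N"
    by (rule bailey_chain[OF q(1)])
  finally show ?thesis
    by (simp only: \<alpha>_def mult_2 power_add mult.assoc)
qed

section \<open>Passage to the limit\<close>

lemma qpoch_LIMSEQ:
  assumes "norm q < 1"
  shows "qpoch a q \<longlonglongrightarrow> qpoch_inf a q"
  unfolding qpoch_def[abs_def]
  by (rule has_prod_imp_tendsto'[OF qpoch_inf_has_prod[OF assms]])

lemma qfact_inf_nonzero:
  assumes "norm q < 1"
  shows "qpoch_inf q q \<noteq> 0"
  unfolding qpoch_inf_def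
proof (rule prodinf_nonzero)
  show "convergent_prod (\<lambda>m. 1 - q * q ^ m)"
    using qpoch_inf_has_prod[OF assms] by (simp add: has_prod_iff)
  show "1 - q * q ^ m \<noteq> 0" for m
    using power_neq_one[OF assms, of "Suc m"] by auto
qed

lemma inverse_qfact_LIMSEQ:
  assumes "norm q < 1"
  shows "(\<lambda>n. 1 / qfact q n) \<longlonglongrightarrow> 1 / qpoch_inf q q"
  by (intro tendsto_intros qpoch_LIMSEQ qfact_inf_nonzero assms)

lemma inverse_qfact_diff_LIMSEQ:
  assumes "norm q < 1"
  shows "(\<lambda>N. 1 / qfact q (N - n)) \<longlonglongrightarrow> 1 / qpoch_inf q q"
  by (rule LIMSEQ_offset[of _ n]) (use inverse_qfact_LIMSEQ[OF assms] in simp)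

lemma inverse_qfact_bounded:
  assumes "norm q < 1"
  obtains K where "K > 0" "\<And>n. norm (1 / qfact q n) \<le> K"
  using convergent_imp_Bseq[OF convergentI[OF inverse_qfact_LIMSEQ[OF assms]]]
  unfolding Bseq_def by auto

text \<open>
  Dominated convergence in the form used below: the summands factor into a summable \<open>a\<close> and
  bounded weights that all tend to the same limit.
\<close>

lemma sum_tendsto_Tannery:
  fixes a :: "nat \<Rightarrow> complex" and c :: "nat \<Rightarrow> nat \<Rightarrow> complex"
  assumes a: "summable (\<lambda>n. norm (a n))"
    and lim: "\<And>n. (\<lambda>N. c N n) \<longlonglongrightarrow> L"
    and bound: "\<And>N n. n \<le> N \<Longrightarrow> norm (c N n) \<le> K"
  shows "(\<lambda>N. \<Sum>n\<le>N. a n * c N n) \<longlonglongrightarrow> (\<Sum>n. a n) * L"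
proof -
  define b where "b n N = (if n \<le> N then a n * c N n else 0)" for n N
  have K: "K \<ge> 0"
    using bound[of 0 0] norm_ge_zero[of "c 0 0"] by linarith
  have "(\<lambda>N. \<Sum>n. b n N) \<longlonglongrightarrow> (\<Sum>n. a n * L)"
  proof (rule tannerys_theorem[THEN conjunct2, THEN conjunct2])
    fix n
    have "eventually (\<lambda>N. a n * c N n = b n N) sequentially"
      using eventually_ge_at_top[of n] by eventually_elim (simp add: b_def)
    then show "(\<lambda>N. b n N) \<longlonglongrightarrow> a n * L"
      by (rule Lim_transform_eventually[rotated]) (intro tendsto_intros lim)
  next
    show "eventually (\<lambda>(n, N). norm (b n N) \<le> norm (a n) * K) (sequentially \<times>\<^sub>F sequentially)"
      using K bound by (intro always_eventually) (auto simp: b_def norm_mult intro!: mult_left_mono)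
  qed (use a summable_mult2 in auto)
  moreover have "(\<Sum>n. b n N) = (\<Sum>n\<le>N. a n * c N n)" for N
    by (subst suminf_finite[of "{..N}"]) (auto simp: b_def)
  moreover have "(\<Sum>n. a n * L) = (\<Sum>n. a n) * L"
    using a by (simp add: suminf_mult2 summable_norm_cancel)
  ultimately show ?thesis by simp
qed

lemma bailey_sum_LIMSEQ:
  assumes q: "norm q < 1" and \<alpha>: "summable (\<lambda>r. norm (\<alpha> r))"
  shows "bailey_sum q e \<alpha> \<longlonglongrightarrow> (\<Sum>r. \<alpha> r) * (1 / qpoch_inf q q * (1 / qpoch_inf q q))"
proof -
  obtain K where K: "K > 0" "\<And>n. norm (1 / qfact q n) \<le> K"
    using inverse_qfact_bounded[OF q] by blast
  have shift: "(\<lambda>N. 1 / qfact q (N - r)) \<longlonglongrightarrow> 1 / qpoch_inf q q"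
    "(\<lambda>N. 1 / qfact q (N + r + e)) \<longlonglongrightarrow> 1 / qpoch_inf q q" for r
  proof -
    show "(\<lambda>N. 1 / qfact q (N - r)) \<longlonglongrightarrow> 1 / qpoch_inf q q"
      by (rule inverse_qfact_diff_LIMSEQ[OF q])
    show "(\<lambda>N. 1 / qfact q (N + r + e)) \<longlonglongrightarrow> 1 / qpoch_inf q q"
      using LIMSEQ_ignore_initial_segment[OF inverse_qfact_LIMSEQ[OF q], of "r + e"]
      by (simp add: add.assoc)
  qed
  have "(\<lambda>N. \<Sum>r\<le>N. \<alpha> r * (1 / qfact q (N - r) * (1 / qfact q (N + r + e)))) \<longlonglongrightarrow>
      (\<Sum>r. \<alpha> r) * (1 / qpoch_inf q q * (1 / qpoch_inf q q))"
  proof (rule sum_tendsto_Tannery[OF \<alpha>])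
    show "norm (1 / qfact q (N - r) * (1 / qfact q (N + r + e))) \<le> K * K" for N r
      unfolding norm_mult using K by (intro mult_mono) auto
  qed (intro tendsto_mult shift)
  then show ?thesis
    by (simp add: bailey_sum_def[abs_def])
qed

text \<open>
  Jacobi's triple product, obtained from its finite form for \<open>n \<rightarrow> \<infinity>\<close>. Here the theta series is
  folded to a series over the naturals, and either way of folding it gives the same product.
\<close>

lemma triple_product_series:
  assumes q: "norm q < 1" "q \<noteq> 0" and zw: "z * w = q" and e: "e \<le> 1"
    and sm: "summable (\<lambda>r. norm (theta_term e q z w r))"
  shows "(\<Sum>r. theta_term e q z w r) = qpoch_inf z q * qpoch_inf w q * qpoch_inf q q"
proof -
  have "(\<lambda>n. qpoch z q (n + e) * qpoch w q n * (1 / qfact q (2 * n + e))) \<longlonglongrightarrow>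
      qpoch_inf z q * qpoch_inf w q * (1 / qpoch_inf q q)"
  proof (intro tendsto_mult LIMSEQ_ignore_initial_segment qpoch_LIMSEQ q)
    have "strict_mono (\<lambda>n. 2 * n + e)" by (simp add: strict_mono_def)
    then show "(\<lambda>n. 1 / qfact q (2 * n + e)) \<longlonglongrightarrow> 1 / qpoch_inf q q"
      using LIMSEQ_subseq_LIMSEQ[OF inverse_qfact_LIMSEQ[OF q(1)]] by (simp add: o_def)
  qed
  moreover have "bailey_sum q e (theta_term e q z w) =
      (\<lambda>n. qpoch z q (n + e) * qpoch w q n * (1 / qfact q (2 * n + e)))"
    by (simp add: fun_eq_iff finite_triple_product[OF q zw e])
  ultimately have "(\<Sum>r. theta_term e q z w r) * (1 / qpoch_inf q q * (1 / qpoch_inf q q)) =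
      qpoch_inf z q * qpoch_inf w q * (1 / qpoch_inf q q)"
    using LIMSEQ_unique[OF bailey_sum_LIMSEQ[OF q(1) sm, of e]] by simp
  then show ?thesis
    using qfact_inf_nonzero[OF q(1)] by (simp add: field_simps)
qed

section \<open>The Rogers-Ramanujan identities\<close>

text \<open>
  The two chain steps multiply the terms by \<open>q^(2r(r+e))\<close>. Since \<open>2 r^2 = 4 \<cdot> r(r-1)/2 + 2 r\<close>, the outcome
  is again a theta series, in the base \<open>q^5\<close>. This is where the modulus 5 of the Rogers-Ramanujan
  identities comes from.
\<close>

lemma theta_term_base_change:
  assumes e: "e \<le> 1"
  shows "q ^ (2 * (r * (r + e))) * theta_term e q (q ^ e) (q ^ (1 - e)) r =
         theta_term e (q ^ 5) (q ^ (2 - e)) (q ^ (3 + e)) r"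
proof -
  have r: "2 * (r * r) + (r choose 2) = 5 * (r choose 2) + 2 * r"
    using double_choose_two[of r] by (simp add: algebra_simps)
  consider "e = 0" | "e = 1" using e by linarith
  then show ?thesis
  proof cases
    case 1
    have E: "q ^ (2 * (r * r)) * q ^ (r choose 2) = (q ^ 5) ^ (r choose 2) * (q ^ 2) ^ r"
      by (simp only: flip: power_add power_mult) (simp only: r)
    have cube: "(q ^ 3) ^ r = (q ^ 2) ^ r * q ^ r"
      by (simp flip: power_mult power_add)
    show ?thesis
    proof (cases "r = 0")
      case False
      have "q ^ (2 * (r * r)) * theta_term 0 q 1 q r =
          (- 1) ^ r * (q ^ (2 * (r * r)) * q ^ (r choose 2)) * (1 + q ^ r)"
        using False by (simp add: theta_term_def)
      also have "\<dots> = theta_term 0 (q ^ 5) (q ^ 2) (q ^ 3) r"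
        unfolding E using False by (simp add: theta_term_def cube ring_distribs mult_ac)
      finally show ?thesis by (simp add: 1)
    qed (simp add: 1 theta_term_def numeral_2_eq_2)
  next
    case 2
    have E: "q ^ (2 * (r * (r + 1))) * q ^ (r choose 2) = (q ^ 5) ^ (r choose 2) * (q ^ 4) ^ r"
      using r by (simp only: flip: power_add power_mult) (simp add: algebra_simps)
    have fifth: "(q ^ 5) ^ r = (q ^ 4) ^ r * q ^ r"
      by (simp flip: power_mult power_add)
    have "q ^ (2 * (r * (r + 1))) * theta_term 1 q q 1 r =
        (- 1) ^ r * (q ^ (2 * (r * (r + 1))) * q ^ (r choose 2)) * (1 - q ^ r * q ^ Suc r)"
      by (simp only: theta_term_def power_one if_False one_neq_zero mult_ac)
    also have "\<dots> = theta_term 1 (q ^ 5) q (q ^ 4) r"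
      unfolding E by (simp add: theta_term_def fifth algebra_simps)
    finally show ?thesis by (simp add: 2)
  qed
qed

lemma summable_theta_term:
  assumes q: "norm q < 1" and e: "e \<le> 1"
  shows "summable (\<lambda>r. norm (q ^ (2 * (r * (r + e))) * theta_term e q (q ^ e) (q ^ (1 - e)) r))"
proof (rule summable_comparison_test)
  have pow: "norm (q ^ n) \<le> 1" for n
    using q by (simp add: norm_power power_le_one)
  have "norm (theta_term e q (q ^ e) (q ^ (1 - e)) r) \<le> 2" for r
  proof -
    have two: "norm (x + y) \<le> 2" "norm (x - y) \<le> 2" if "norm x \<le> 1" "norm y \<le> 1" for x y :: complex
      using norm_triangle_ineq[of x y] norm_triangle_ineq4[of x y] that by linarith+
    have "norm (if e = 0 then if r = 0 then 1 else (q ^ e) ^ r + (q ^ (1 - e)) ^ r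
        else (q ^ (1 - e)) ^ r - q ^ r * (q ^ e) ^ Suc r) \<le> 2"
      unfolding power_mult[symmetric] power_add[symmetric]
      using two(1)[OF pow pow, of "e * r" "(1 - e) * r"] two(2)[OF pow pow, of "(1 - e) * r" "r + e * Suc r"]
      by (simp only: split: if_split) simp
    then show ?thesis
      unfolding theta_term_def norm_mult
      using mult_mono[OF pow[of "r choose 2"], of "norm (if e = 0 then if r = 0 then 1 else (q ^ e) ^ r + (q ^ (1 - e)) ^ r
        else (q ^ (1 - e)) ^ r - q ^ r * (q ^ e) ^ Suc r)" 2]
      by (simp add: norm_power)
  qed
  then have "norm (q ^ (2 * (r * (r + e)))) * norm (theta_term e q (q ^ e) (q ^ (1 - e)) r) \<le>
      norm q ^ r * 2" for r
  proof (intro mult_mono)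
    have "r \<le> 2 * (r * (r + e))" by (cases r) auto
    then show "norm (q ^ (2 * (r * (r + e)))) \<le> norm q ^ r"
      using q by (simp add: norm_power power_decreasing)
  qed auto
  then show "\<exists>N. \<forall>r\<ge>N. norm (norm (q ^ (2 * (r * (r + e))) *
      theta_term e q (q ^ e) (q ^ (1 - e)) r)) \<le> norm q ^ r * 2"
    by (simp add: norm_mult)
  show "summable (\<lambda>r. norm q ^ r * 2)"
    using q by (intro summable_mult2 summable_geometric) simp
qed

lemma summable_Rogers_Ramanujan:
  assumes q: "norm q < 1"
  shows "summable (\<lambda>n. norm (q ^ (n * (n + e)) / qfact q n))"
proof -
  obtain K where K: "K > 0" "\<And>n. norm (1 / qfact q n) \<le> K"
    using inverse_qfact_bounded[OF q] by blast
  have "norm (q ^ (n * (n + e))) * norm (1 / qfact q n) \<le> norm q ^ n * K" for n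
  proof (intro mult_mono)
    have "n \<le> n * (n + e)" by (cases n) auto
    then show "norm (q ^ (n * (n + e))) \<le> norm q ^ n"
      using q by (simp add: norm_power power_decreasing)
  qed (use K in auto)
  then have "\<exists>N. \<forall>n\<ge>N. norm (norm (q ^ (n * (n + e)) / qfact q n)) \<le> norm q ^ n * K"
    by (simp add: norm_divide)
  moreover have "summable (\<lambda>n. norm q ^ n * K)"
    using q by (intro summable_mult2 summable_geometric) simp
  ultimately show ?thesis by (rule summable_comparison_test)
qed

text \<open>
  Both sides of \<open>bailey_chain_twice\<close> converge for \<open>N \<rightarrow> \<infinity>\<close>; the triple product in the base \<open>q^5\<close>
  evaluates the limit on the right. The value \<open>q = 0\<close> is separate because the finite triple product
  divides by powers of \<open>q\<close>.
\<close>

theorem Rogers_Ramanujan: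
  assumes q: "norm q < 1" and e: "e \<le> 1"
  shows "(\<Sum>n. q ^ (n * (n + e)) / qfact q n) =
    qpoch_inf (q ^ (2 - e)) (q ^ 5) * qpoch_inf (q ^ (3 + e)) (q ^ 5) * qpoch_inf (q ^ 5) (q ^ 5)
      / qpoch_inf q q"
proof (cases "q = 0")
  case True
  have "(\<lambda>n. q ^ (n * (n + e)) / qfact q n) = (\<lambda>n. if n = 0 then 1 else 0)"
    using True by (auto simp: fun_eq_iff)
  moreover have "qpoch_inf 0 0 = 1"
    by (simp add: qpoch_inf_def)
  ultimately show ?thesis
    using True e zero_power[of "2 - e"] suminf_finite[of "{0}" "\<lambda>n. if n = 0 then 1 else 0 :: complex"]
    by (simp add: zero_power)
next
  case False
  have q5: "norm (q ^ 5) < 1" "q ^ 5 \<noteq> 0"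
    using q False by (auto simp: norm_power power_less_one_iff)
  have zw: "q ^ (2 - e) * q ^ (3 + e) = q ^ 5"
    using e by (simp flip: power_add)
  have "(\<lambda>N. \<Sum>n\<le>N. q ^ (n * (n + e)) / qfact q n * (1 / qfact q (N - n))) \<longlonglongrightarrow>
      (\<Sum>n. q ^ (n * (n + e)) / qfact q n) * (1 / qpoch_inf q q)"
  proof -
    obtain K where K: "K > 0" "\<And>n. norm (1 / qfact q n) \<le> K"
      using inverse_qfact_bounded[OF q] by blast
    show ?thesis
      by (rule sum_tendsto_Tannery[OF summable_Rogers_Ramanujan[OF q]
            inverse_qfact_diff_LIMSEQ[OF q] K(2)])
  qed
  moreover have "(\<lambda>N. \<Sum>n\<le>N. q ^ (n * (n + e)) / qfact q n * (1 / qfact q (N - n))) \<longlonglongrightarrow>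
      (\<Sum>r. theta_term e (q ^ 5) (q ^ (2 - e)) (q ^ (3 + e)) r) *
        (1 / qpoch_inf q q * (1 / qpoch_inf q q))"
    using bailey_sum_LIMSEQ[OF q summable_theta_term[OF q e], of e]
      bailey_chain_twice[OF q False e]
    unfolding theta_term_base_change[OF e] by simp
  ultimately have "(\<Sum>n. q ^ (n * (n + e)) / qfact q n) * (1 / qpoch_inf q q) =
      (\<Sum>r. theta_term e (q ^ 5) (q ^ (2 - e)) (q ^ (3 + e)) r) *
        (1 / qpoch_inf q q * (1 / qpoch_inf q q))"
    by (rule LIMSEQ_unique)
  moreover have "(\<Sum>r. theta_term e (q ^ 5) (q ^ (2 - e)) (q ^ (3 + e)) r) =
     qpoch_inf (q ^ (2 - e)) (q ^ 5) * qpoch_inf (q ^ (3 + e)) (q ^ 5) * qpoch_inf (q ^ 5) (q ^ 5)"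
    using summable_theta_term[OF q e] unfolding theta_term_base_change[OF e]
    by (rule triple_product_series[OF q5 zw e])
  ultimately show ?thesis
    using qfact_inf_nonzero[OF q] by (simp add: field_simps)
qed

section \<open>Evaluation of the triple sum\<close>

text \<open>
  The limit of the q-binomial theorem, by dominated convergence: for fixed \<open>k\<close> the Gaussian
  binomial in row \<open>N\<close> tends to \<open>1 / (q;q)\<^sub>k\<close>.
\<close>

theorem Euler_series:
  assumes q: "norm q < 1" and x: "norm x < 1"
  shows "((\<lambda>k. q ^ (k choose 2) * x ^ k / qfact q k) has_sum qpoch_inf (- x) q) UNIV"
proof -
  obtain K where K: "K > 0" "\<And>n. norm (1 / qfact q n) \<le> K"
    using inverse_qfact_bounded[OF q] by blast
  define a where "a k = q ^ (k choose 2) * x ^ k / qfact q k" for k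
  have sm: "summable (\<lambda>k. norm (a k))"
  proof (rule summable_comparison_test)
    have "norm (q ^ (k choose 2)) * norm (x ^ k) * norm (1 / qfact q k) \<le> 1 * norm x ^ k * K" for k
      using q K by (intro mult_mono) (auto simp: norm_power power_le_one)
    then show "\<exists>N. \<forall>k\<ge>N. norm (norm (a k)) \<le> norm x ^ k * K"
      by (simp add: a_def norm_mult norm_divide)
    show "summable (\<lambda>k. norm x ^ k * K)"
      using x by (intro summable_mult2 summable_geometric) simp
  qed
  obtain M where M: "\<And>n. norm (qfact q n) \<le> M"
    using convergent_imp_Bseq[OF convergentI[OF qpoch_LIMSEQ[OF q]]] unfolding Bseq_def by auto
  have "(\<lambda>N. \<Sum>k\<le>N. a k * (qfact q N * (1 / qfact q (N - k)))) \<longlonglongrightarrow>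
      (\<Sum>k. a k) * (qpoch_inf q q * (1 / qpoch_inf q q))"
  proof (rule sum_tendsto_Tannery[OF sm])
    show "(\<lambda>N. qfact q N * (1 / qfact q (N - k))) \<longlonglongrightarrow> qpoch_inf q q * (1 / qpoch_inf q q)" for k
      by (intro tendsto_mult qpoch_LIMSEQ inverse_qfact_diff_LIMSEQ q)
    have "0 \<le> M" using M[of 0] norm_ge_zero order_trans by blast
    then show "norm (qfact q N * (1 / qfact q (N - k))) \<le> M * K" for N k
      unfolding norm_mult using M K by (intro mult_mono) auto
  qed
  moreover have "(\<Sum>k\<le>N. a k * (qfact q N * (1 / qfact q (N - k)))) = qpoch (- x) q N" for N
  proof -
    have "(\<Sum>k\<le>N. a k * (qfact q N * (1 / qfact q (N - k)))) =
        (\<Sum>k\<le>N. qbinom q N k * (q ^ (k choose 2) * x ^ k))"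
      by (intro sum.cong) (auto simp: a_def qbinom_def)
    then show ?thesis
      by (simp add: q_binomial_theorem[OF q] qpoch_def)
  qed
  ultimately have "(\<Sum>k. a k) = qpoch_inf (- x) q"
    using LIMSEQ_unique[OF _ qpoch_LIMSEQ[OF q]] qfact_inf_nonzero[OF q] by simp
  then have "a sums qpoch_inf (- x) q"
    using summable_sums[OF summable_norm_cancel[OF sm]] by simp
  then show ?thesis
    using norm_summable_imp_has_sum[OF sm] by (simp add: a_def[abs_def])
qed

lemma qpoch_square: "qpoch (a ^ 2) (q ^ 2) n = qpoch a q n * qpoch (- a) q n"
  by (induction n) (simp_all add: qpoch_Suc algebra_simps power2_eq_square power_mult_distrib)

lemma qpoch_inf_square:
  assumes q: "norm q < 1"
  shows "qpoch_inf (a ^ 2) (q ^ 2) = qpoch_inf a q * qpoch_inf (- a) q"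
proof -
  have q2: "norm (q ^ 2) < 1" using q by (simp add: norm_power power_less_one_iff)
  have "qpoch (a ^ 2) (q ^ 2) \<longlonglongrightarrow> qpoch_inf a q * qpoch_inf (- a) q"
    unfolding qpoch_square[abs_def] by (intro tendsto_mult qpoch_LIMSEQ q)
  then show ?thesis
    using LIMSEQ_unique[OF qpoch_LIMSEQ[OF q2]] by blast
qed

lemma qpoch_inf_split:
  assumes q: "norm q < 1"
  shows "qpoch_inf a q = qpoch a q n * qpoch_inf (a * q ^ n) q"
proof -
  have "(\<lambda>m. qpoch a q n * qpoch (a * q ^ n) q m) \<longlonglongrightarrow> qpoch a q n * qpoch_inf (a * q ^ n) q"
    by (intro tendsto_intros qpoch_LIMSEQ q)
  then have "(\<lambda>m. qpoch a q (m + n)) \<longlonglongrightarrow> qpoch a q n * qpoch_inf (a * q ^ n) q"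
    by (simp add: qpoch_add add.commute flip: qpoch_add)
  then show ?thesis
    using LIMSEQ_unique[OF LIMSEQ_ignore_initial_segment[OF qpoch_LIMSEQ[OF q]]] by blast
qed

definition weighted_pairs :: "nat \<Rightarrow> (nat \<times> nat) set" where
  "weighted_pairs n = {(j, k). j + 2 * k = n}"

lemma finite_weighted_pairs [simp]: "finite (weighted_pairs n)"
  by (rule finite_subset[of _ "{..n} \<times> {..n}"]) (auto simp: weighted_pairs_def)

text \<open>
  In terms of generating functions this is \<open>(-z;q)\<^sub>\<infinity> / (z^2;q^2)\<^sub>\<infinity> = 1 / (z;q)\<^sub>\<infinity>\<close>, compared at
  \<open>z^n\<close>. The proof is elementary: splitting
  \<open>1 - q^(j+2k) = (1 - q^(2k)) + q^(2k) (1 - q^j)\<close> lowers \<open>k\<close> in the first part and \<open>j\<close> in the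
  second. Hence the sums \<open>c(n)\<close> satisfy \<open>(1 - q^(n+2)) c(n+2) = c(n) + q^(n+1) c(n+1)\<close>, a
  recurrence shared by \<open>1 / (q;q)\<^sub>n\<close>, and the first two values agree.
\<close>

lemma sum_weighted_pairs:
  assumes q: "norm q < 1"
  shows "(\<Sum>(j, k)\<in>weighted_pairs n. q ^ (j choose 2) / (qfact q j * qfact (q ^ 2) k)) = 1 / qfact q n"
proof -
  have q2: "norm (q ^ 2) < 1" using q by (simp add: norm_power power_less_one_iff)
  define a where "a j = q ^ (j choose 2) / qfact q j" for j
  define b where "b k = 1 / qfact (q ^ 2) k" for k
  define c where "c n = (\<Sum>(j, k)\<in>weighted_pairs n. a j * b k)" for n
  have a_Suc: "(1 - q ^ Suc j) * a (Suc j) = q ^ j * a j" for j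
    using power_neq_one[OF q, of "Suc j"] qfact_nonzero[OF q]
    by (simp add: a_def qfact_Suc Suc_choose_two power_add field_simps)
  have b_Suc: "(1 - q ^ (2 * Suc k)) * b (Suc k) = b k" for k
    using power_neq_one[OF q2, of "Suc k"] qfact_nonzero[OF q2]
    unfolding power_mult by (simp add: b_def qfact_Suc field_simps)
  have rec: "(1 - q ^ Suc (Suc n)) * c (Suc (Suc n)) = c n + q ^ Suc n * c (Suc n)" for n
  proof -
    have "(1 - q ^ Suc (Suc n)) * c (Suc (Suc n)) =
        (\<Sum>(j, k)\<in>weighted_pairs (Suc (Suc n)).
           a j * ((1 - q ^ (2 * k)) * b k) + q ^ (2 * k) * ((1 - q ^ j) * a j) * b k)"
      unfolding c_def sum_distrib_left
    proof (intro sum.cong refl, clarify)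
      fix j k assume "(j, k) \<in> weighted_pairs (Suc (Suc n))"
      then have "q ^ Suc (Suc n) = q ^ (2 * k) * q ^ j"
        unfolding power_add[symmetric] weighted_pairs_def by (auto simp: add.commute)
      then show "(1 - q ^ Suc (Suc n)) * (a j * b k) =
          a j * ((1 - q ^ (2 * k)) * b k) + q ^ (2 * k) * ((1 - q ^ j) * a j) * b k"
        by (simp only:) (simp add: algebra_simps)
    qed
    also have "\<dots> = (\<Sum>(j, k)\<in>weighted_pairs (Suc (Suc n)). a j * ((1 - q ^ (2 * k)) * b k)) +
        (\<Sum>(j, k)\<in>weighted_pairs (Suc (Suc n)). q ^ (2 * k) * ((1 - q ^ j) * a j) * b k)"
      by (simp add: sum.distrib case_prod_unfold)
    \<comment> \<open>The factor \<open>1 - q ^ (2 * k)\<close> removes \<open>k = 0\<close>, so \<open>k\<close> can be lowered by one, leaving weight \<open>n\<close>.\<close>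
    also have "(\<Sum>(j, k)\<in>weighted_pairs (Suc (Suc n)). a j * ((1 - q ^ (2 * k)) * b k)) =
        (\<Sum>(j, k)\<in>weighted_pairs (Suc (Suc n)) \<inter> {(j, k). k \<noteq> 0}. a j * ((1 - q ^ (2 * k)) * b k))"
      by (rule sum.mono_neutral_right) (auto intro!: gr0I)
    also have "\<dots> = c n"
      unfolding c_def
    proof (rule sum.reindex_bij_witness[of _ "\<lambda>(j, k). (j, Suc k)" "\<lambda>(j, k). (j, k - 1)"], goal_cases)
      case (5 p)
      then obtain j k where p: "p = (j, Suc k)"
        by (auto simp: gr0_conv_Suc)
      show ?case
        unfolding p by (simp only: prod.case b_Suc diff_Suc_1)
    qed (auto simp: weighted_pairs_def)
    \<comment> \<open>Likewise \<open>1 - q ^ j\<close> removes \<open>j = 0\<close>, and lowering \<open>j\<close> by one leaves weight \<open>n + 1\<close>.\<close>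
    also have "(\<Sum>(j, k)\<in>weighted_pairs (Suc (Suc n)). q ^ (2 * k) * ((1 - q ^ j) * a j) * b k) =
        (\<Sum>(j, k)\<in>weighted_pairs (Suc (Suc n)) \<inter> {(j, k). j \<noteq> 0}. q ^ (2 * k) * ((1 - q ^ j) * a j) * b k)"
      by (rule sum.mono_neutral_right) (auto intro!: gr0I)
    also have "\<dots> = (\<Sum>(j, k)\<in>weighted_pairs (Suc n). q ^ Suc n * (a j * b k))"
    proof (rule sum.reindex_bij_witness[of _ "\<lambda>(j, k). (Suc j, k)" "\<lambda>(j, k). (j - 1, k)"], goal_cases)
      case (5 p)
      then obtain j k where p: "p = (Suc j, k)" "j + 2 * k = Suc n"
        by (auto simp: weighted_pairs_def gr0_conv_Suc)
      have "q ^ Suc n = q ^ (2 * k) * q ^ j"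
        unfolding p(2)[symmetric] by (simp add: power_add mult.commute)
      then show ?case
        unfolding p by (simp only: prod.case a_Suc diff_Suc_1) (simp only: mult_ac)
    qed (auto simp: weighted_pairs_def)
    also have "\<dots> = q ^ Suc n * c (Suc n)"
      by (simp add: c_def sum_distrib_left case_prod_unfold)
    finally show ?thesis .
  qed
  have "c n = 1 / qfact q n"
  proof (induction n rule: induct_nat_012)
    case 0
    have "weighted_pairs 0 = {(0, 0)}" by (auto simp: weighted_pairs_def)
    then show ?case by (simp add: c_def a_def b_def numeral_2_eq_2)
  next
    case 1
    have "j = 1 \<and> k = 0" if "j + 2 * k = 1" for j k :: nat
      using that by presburger
    then have "weighted_pairs 1 = {(1, 0)}" by (fastforce simp: weighted_pairs_def)
    then show ?case by (simp add: c_def a_def b_def numeral_2_eq_2)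
  next
    case (ge2 n)
    have nz: "1 - q ^ Suc n \<noteq> 0" "1 - q ^ Suc (Suc n) \<noteq> 0" "qfact q n \<noteq> 0"
      using power_neq_one[OF q, of "Suc n"] power_neq_one[OF q, of "Suc (Suc n)"] qfact_nonzero[OF q]
      by auto
    have "(1 - q ^ Suc (Suc n)) * c (Suc (Suc n)) = 1 / qfact q n + q ^ Suc n * (1 / qfact q (Suc n))"
      unfolding rec ge2 ..
    also have "\<dots> = 1 / qfact q (Suc n)"
      unfolding qfact_Suc[of q n] using nz by (simp add: divide_simps)
    finally show ?case
      unfolding qfact_Suc[of q "Suc n"] using nz qfact_nonzero[OF q, of "Suc n"] by (simp add: field_simps)
  qed
  then show ?thesis
    by (simp add: c_def a_def b_def case_prod_unfold)
qed

text \<open>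
  Both exponents at once, arranged for the summation in layers: the summand with \<open>i\<close> belongs to
  Euler's series, \<open>j choose 2\<close> to the sum over pairs of weight \<open>j + 2 * k\<close>, and the last
  summand depends on the weight only.
\<close>

definition quad_expo :: "nat \<Rightarrow> nat \<Rightarrow> nat \<Rightarrow> nat \<Rightarrow> nat" where
  "quad_expo e i j k = (i choose 2) + (1 + (j + 2 * k)) * i + (j choose 2) +
     2 * ((j + 2 * k) * ((j + 2 * k) + e))"

lemma expo1_eq: "expo1 i j k = quad_expo 0 i j k"
proof -
  have "i^2 + 5*j^2 + 16*k^2 + 2*i*j + 4*i*k + 16*j*k + i = 2 * quad_expo 0 i j k + j"
    using double_choose_two[of i] double_choose_two[of j]
    by (simp add: quad_expo_def algebra_simps power2_eq_square)
  then show ?thesis by (simp add: expo1_def)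
qed

lemma expo2_eq: "expo2 i j k = quad_expo 1 i j k"
proof -
  have "i^2 + 5*j^2 + 16*k^2 + 2*i*j + 4*i*k + 16*j*k + i + 3*j + 8*k = 2 * quad_expo 1 i j k"
    using double_choose_two[of i] double_choose_two[of j]
    by (simp add: quad_expo_def algebra_simps power2_eq_square)
  then show ?thesis by (simp add: expo2_def)
qed

lemma summable_triple:
  assumes q: "norm q < 1"
  shows "(\<lambda>(i, j, k). q ^ quad_expo e i j k / (qfact q i * qfact q j * qfact (q ^ 2) k)) summable_on UNIV"
proof -
  have q2: "norm (q ^ 2) < 1" using q by (simp add: norm_power power_less_one_iff)
  define \<rho> where "\<rho> = norm q"
  have \<rho>: "0 \<le> \<rho>" "\<rho> < 1" using q by (auto simp: \<rho>_def)
  obtain K where K: "K > 0" "\<And>n. norm (1 / qfact q n) \<le> K"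
    using inverse_qfact_bounded[OF q] by blast
  obtain L where L: "L > 0" "\<And>n. norm (1 / qfact (q ^ 2) n) \<le> L"
    using inverse_qfact_bounded[OF q2] by blast
  have geo: "((\<lambda>n. \<rho> ^ n) has_sum (1 / (1 - \<rho>))) UNIV"
    using geometric_sums[of \<rho>] \<rho> by (intro sums_nonneg_imp_has_sum) auto
  have "(\<lambda>(j, k). \<rho> ^ j * \<rho> ^ k) summable_on (UNIV \<times> UNIV)"
  proof (rule summable_on_SigmaI)
    show "((\<lambda>k. case (j, k) of (j, k) \<Rightarrow> \<rho> ^ j * \<rho> ^ k) has_sum \<rho> ^ j * (1 / (1 - \<rho>))) UNIV" for j
      using has_sum_cmult_right[OF geo] by simp
    show "(\<lambda>j. \<rho> ^ j * (1 / (1 - \<rho>))) summable_on UNIV"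
      using has_sum_cmult_left[OF geo] unfolding summable_on_def by blast
  qed (use \<rho> in auto)
  then obtain S where S: "((\<lambda>(j, k). \<rho> ^ j * \<rho> ^ k) has_sum S) UNIV"
    by (auto simp: summable_on_def)
  have "(\<lambda>(i, p). \<rho> ^ i * (\<lambda>(j, k). \<rho> ^ j * \<rho> ^ k) p) summable_on (UNIV \<times> UNIV)"
  proof (rule summable_on_SigmaI)
    show "((\<lambda>p. case (i, p) of (i, p) \<Rightarrow> \<rho> ^ i * (\<lambda>(j, k). \<rho> ^ j * \<rho> ^ k) p) has_sum \<rho> ^ i * S) UNIV" for i
      using has_sum_cmult_right[OF S] by simp
    show "(\<lambda>i. \<rho> ^ i * S) summable_on UNIV"
      using has_sum_cmult_left[OF geo] unfolding summable_on_def by blast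
  qed (use \<rho> in auto)
  then have "(\<lambda>p. (\<lambda>(i, p). \<rho> ^ i * (\<lambda>(j, k). \<rho> ^ j * \<rho> ^ k) p) p * (K * K * L)) summable_on UNIV"
    by (intro summable_on_cmult_left) simp
  then have "(\<lambda>p. norm ((\<lambda>(i, j, k). q ^ quad_expo e i j k / (qfact q i * qfact q j * qfact (q ^ 2) k)) p))
      summable_on UNIV"
  proof (rule Infinite_Sum.abs_summable_on_comparison_test', safe)
    fix i j k
    have "i + (j + k) \<le> quad_expo e i j k"
    proof -
      have "n \<le> n * (n + e)" for n by (cases n) auto
      from this[of "j + 2 * k"] show ?thesis by (simp add: quad_expo_def algebra_simps)
    qed
    then have "norm (q ^ quad_expo e i j k) \<le> \<rho> ^ (i + (j + k))"
      unfolding \<rho>_def norm_power using q by (intro power_decreasing) auto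
    then have "norm (q ^ quad_expo e i j k) *
        (norm (1 / qfact q i) * norm (1 / qfact q j) * norm (1 / qfact (q ^ 2) k)) \<le>
        \<rho> ^ (i + (j + k)) * (K * K * L)"
      using K L \<rho> by (intro mult_mono) auto
    then show "norm (q ^ quad_expo e i j k / (qfact q i * qfact q j * qfact (q ^ 2) k)) \<le>
        \<rho> ^ i * (\<rho> ^ j * \<rho> ^ k) * (K * K * L)"
      by (simp add: norm_mult norm_divide power_add)
  qed
  then show ?thesis
    by (rule Infinite_Sum.abs_summable_summable)
qed

text \<open>
  The triples are grouped by weight \<open>n = j + 2 * k\<close>, then by \<open>(j, k)\<close>. Summing over \<open>i\<close>,
  over the pairs of weight \<open>n\<close>, and over \<open>n\<close> leaves the Rogers-Ramanujan series
  in the base \<open>q^2\<close>.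
\<close>

theorem has_sum_triple:
  assumes q: "norm q < 1" and e: "e \<le> 1"
  shows "((\<lambda>(i, j, k). q ^ quad_expo e i j k / (qfact q i * qfact q j * qfact (q ^ 2) k)) has_sum
     qpochs_inf [(q ^ 2) ^ (2 - e), (q ^ 2) ^ (3 + e), (q ^ 2) ^ 5] ((q ^ 2) ^ 5) / qpoch_inf q q) UNIV"
    (is "(?f has_sum ?S) UNIV")
proof -
  have q2: "norm (q ^ 2) < 1" using q by (simp add: norm_power power_less_one_iff)
  define D where "D = weighted_pairs"
  have "(?f has_sum infsum ?f UNIV) UNIV"
    using summable_triple[OF q] by (rule has_sum_infsum)
  also have "(?f has_sum infsum ?f UNIV) UNIV \<longleftrightarrow> ((\<lambda>((n, j, k), i). ?f (i, j, k)) has_sum infsum ?f UNIV) (Sigma UNIV D \<times> UNIV)"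
    by (rule has_sum_reindex_bij_witness
          [where j = "\<lambda>(i, j, k). ((j + 2 * k, j, k), i)" and i = "\<lambda>((n, j, k), i). (i, j, k)"])
       (auto simp: D_def weighted_pairs_def)
  finally have "((\<lambda>(n, j, k). q ^ (2 * (n * (n + e))) * (q ^ (j choose 2) / (qfact q j * qfact (q ^ 2) k)) *
      qpoch_inf (- (q ^ Suc n)) q) has_sum infsum ?f UNIV) (Sigma UNIV D)"
  proof (rule has_sum_SigmaD, goal_cases)
    case (1 p)
    then obtain n j k where p: "p = (n, j, k)" and n: "j + 2 * k = n"
      by (auto simp: D_def weighted_pairs_def)
    define c where "c = q ^ (2 * (n * (n + e))) * (q ^ (j choose 2) / (qfact q j * qfact (q ^ 2) k))"
    have "norm (q ^ Suc n) < 1"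
      using q unfolding norm_power by (simp add: power_less_one_iff del: power_Suc)
    from has_sum_cmult_right[OF Euler_series[OF q this], of c]
    have "((\<lambda>i. c * (q ^ (i choose 2) * (q ^ Suc n) ^ i / qfact q i)) has_sum
        c * qpoch_inf (- (q ^ Suc n)) q) UNIV" .
    moreover have "c * (q ^ (i choose 2) * (q ^ Suc n) ^ i / qfact q i) = ?f (i, j, k)" for i
      unfolding c_def prod.case quad_expo_def n power_mult[symmetric] by (simp add: power_add mult_ac)
    ultimately show ?case
      by (simp add: p c_def)
  qed
  then have "((\<lambda>n. qpoch_inf (- q) q * ((q ^ 2) ^ (n * (n + e)) / qfact (q ^ 2) n)) has_sum
      infsum ?f UNIV) UNIV"
  proof (rule has_sum_SigmaD, goal_cases)
    case (1 n)
    define c where "c = q ^ (2 * (n * (n + e))) * qpoch_inf (- (q ^ Suc n)) q"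
    have "(\<Sum>(j, k)\<in>D n. c * (q ^ (j choose 2) / (qfact q j * qfact (q ^ 2) k))) = c * (1 / qfact q n)"
      unfolding D_def sum_weighted_pairs[OF q, symmetric] by (simp add: sum_distrib_left case_prod_unfold)
    also have "\<dots> = qpoch_inf (- q) q * ((q ^ 2) ^ (n * (n + e)) / qfact (q ^ 2) n)"
    proof -
      have "qpoch_inf (- q) q = qpoch (- q) q n * qpoch_inf (- (q ^ Suc n)) q"
        using qpoch_inf_split[OF q, of "- q" n] by simp
      moreover have "qfact (q ^ 2) n = qfact q n * qpoch (- q) q n"
        by (rule qpoch_square)
      ultimately show ?thesis
        using qfact_nonzero[OF q2, of n] by (simp add: c_def power_mult)
    qed
    finally show ?case
      by (intro has_sum_finiteI) (simp_all add: D_def c_def case_prod_unfold mult_ac)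
  qed
  then have "infsum ?f UNIV = (\<Sum>n. qpoch_inf (- q) q * ((q ^ 2) ^ (n * (n + e)) / qfact (q ^ 2) n))"
    by (intro sums_unique has_sum_imp_sums)
  also have "\<dots> = qpoch_inf (- q) q * (\<Sum>n. (q ^ 2) ^ (n * (n + e)) / qfact (q ^ 2) n)"
    by (rule suminf_mult[OF summable_norm_cancel[OF summable_Rogers_Ramanujan[OF q2]]])
  also have "\<dots> = ?S"
    using Rogers_Ramanujan[OF q2 e] qpoch_inf_square[OF q, of q] qfact_inf_nonzero[OF q] 
      qfact_inf_nonzero[OF q2]
    by (simp add: qpochs_inf_def)
  finally show ?thesis
    using has_sum_infsum[OF summable_triple[OF q, of e]] by simp
qed

theorem theorem3p2:
  fixes q :: complex
  assumes "norm q < 1"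
  shows "((\<lambda>(i, j, k). q ^ expo1 i j k / (qpoch q q i * qpoch q q j * qpoch (q^2) (q^2) k))
           has_sum (qpochs_inf [q^4, q^6, q^10] (q^10) / qpoch_inf q q))
           (UNIV :: (nat \<times> nat \<times> nat) set)
       \<and> ((\<lambda>(i, j, k). q ^ expo2 i j k / (qpoch q q i * qpoch q q j * qpoch (q^2) (q^2) k))
           has_sum (qpochs_inf [q^2, q^8, q^10] (q^10) / qpoch_inf q q))
           (UNIV :: (nat \<times> nat \<times> nat) set)"
  using has_sum_triple[OF assms, of 0] has_sum_triple[OF assms, of 1]
  by (simp add: expo1_eq expo2_eq flip: power_mult)

end
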